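(* The additive quotient group $T^{(3,2)}/T^{(4)}$ is a non-trivial elementary abelian $3$-group.
   Context: $\mathbb{Z}\langle X\rangle$ is the free unitary associative ring freely generated by the infinite countable set $X=\{x_1,x_2,\dots\}$. Commutators are left-normed: $[a,b]=ab-ba$ and $[a_1,\dots,a_n]=[[a_1,\dots,a_{n-1}],a_n]$. $T^{(4)}$ is the two-sided ideal of $\mathbb{Z}\langle X\rangle$ generated by all commutators $[a_1,a_2,a_3,a_4]$ with $a_i\in\mathbb{Z}\langle X\rangle$. $T^{(3,2)}$ is the two-sided ideal of $\mathbb{Z}\langle X\rangle$ generated by all elements $[a_1,a_2,a_3,a_4]$ and $[a_1,a_2,a_3][a_4,a_5]$ with $a_i\in\mathbb{Z}\langle X\rangle$; thus $T^{(4)}\subset T^{(3,2)}$. *)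

theory Defs
  imports "HOL-Library.Poly_Mapping" "HOL-Algebra.Algebra" "HOL-Algebra.Algebraic_Closure_Type"
begin

text \<open>
  Words under concatenation form the free monoid. It is written additively because the
  convolution product on \<^typ>\<open>'m \<Rightarrow>\<^sub>0 'r\<close> is indexed by an additive (not necessarily
  commutative) monoid \<^typ>\<open>'m\<close>.
\<close>

datatype 'a word = Word (letters: "'a list")

instantiation word :: (type) monoid_add
begin

definition zero_word :: "'a word" where
  "0 = Word []"

definition plus_word :: "'a word \<Rightarrow> 'a word \<Rightarrow> 'a word" where
  "u + v = Word (letters u @ letters v)"

instance
  by standard (simp_all add: zero_word_def plus_word_def)

end

text \<open>
  The monoid ring over the integers of the free monoid on countably many letters, that is, the
  free unitary associative ring on them. The letters are indexed from 0, and the generator with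
  index \<open>i\<close> is \<open>Poly_Mapping.single (Word [i]) 1\<close>.
\<close>

type_synonym free_ring = "nat word \<Rightarrow>\<^sub>0 int"

definition ZX :: "free_ring ring" where
  "ZX = ring_of_type_algebra"

lemma ring_ZX: "ring ZX"
proof -
  have "\<exists>y. x + y = 0" for x :: free_ring
    using add.right_inverse by blast
  thus ?thesis
    unfolding ZX_def ring_of_type_algebra_def using add.right_inverse
    by unfold_locales (auto simp: algebra_simps Units_def)
qed

definition commutator :: "'a::ring \<Rightarrow> 'a \<Rightarrow> 'a" where
  "commutator a b = a * b - b * a"

abbreviation commutator3 :: "'a::ring \<Rightarrow> 'a \<Rightarrow> 'a \<Rightarrow> 'a" where
  "commutator3 a b c \<equiv> commutator (commutator a b) c"

abbreviation commutator4 :: "'a::ring \<Rightarrow> 'a \<Rightarrow> 'a \<Rightarrow> 'a \<Rightarrow> 'a" where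
  "commutator4 a b c d \<equiv> commutator (commutator3 a b c) d"

text \<open>\<^const>\<open>genideal\<close> generates two-sided ideals, also in noncommutative rings.\<close>

definition T4 :: "free_ring set" where
  "T4 = Idl\<^bsub>ZX\<^esub> {commutator4 a b c d | a b c d. True}"

definition T32 :: "free_ring set" where
  "T32 = Idl\<^bsub>ZX\<^esub> ({commutator4 a b c d | a b c d. True} \<union>
                  {commutator3 a b c * commutator d e | a b c d e. True})"

text \<open>
  The additive group of cosets of \<^const>\<open>T4\<close> in \<^const>\<open>T32\<close>. Only the carrier and the addition of
  the restricted record matter for \<^const>\<open>A_FactGroup\<close>, so it is harmless that \<^const>\<open>T32\<close> has
  no unit element.
\<close>

definition T32_mod_T4 :: "free_ring set monoid" where
  "T32_mod_T4 = (ZX\<lparr>carrier := T32\<rparr>) A_Mod T4"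

text \<open>Elementary abelian groups may be infinite, and the trivial group is one of them.\<close>

definition elementary_abelian_group :: "nat \<Rightarrow> ('a, 'b) monoid_scheme \<Rightarrow> bool" where
  "elementary_abelian_group p G \<longleftrightarrow>
     Factorial_Ring.prime p \<and> comm_group G \<and>
     (\<forall>x\<in>carrier G. x [^]\<^bsub>G\<^esub> p = \<one>\<^bsub>G\<^esub>)"

end

theory Submission
  imports Defs
begin

text \<open>
  Modulo \<^const>\<open>T4\<close> every triple commutator is central. Expanding $[[a,b],cd,e]$ and
  $[ad,e,b,c]$ with the Leibniz rule then shows that $[a,b,c][d,e]$ changes sign, modulo
  \<^const>\<open>T4\<close>, under transpositions that generate all permutations of its five arguments; so the
  three summands of the Jacobi identity for $[a,b,c]$, multiplied by $[d,e]$, are congruent and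
  $3[a,b,c][d,e]$ lies in \<^const>\<open>T4\<close> (\<open>three_times_mem\<close>). Hence 3 kills the quotient.

  That the quotient is not zero is certified by an additive map from the free ring to the integers
  which is divisible by 3 on all of \<^const>\<open>T4\<close> (\<open>functional_T4\<close>) but not on
  $[x_0,x_1,x_2][x_3,x_4]$ (\<open>T32_neq_T4\<close>). The map only sees words that arrange the five letters
  $x_0,\dots,x_4$. By the first part, $[x_0,x_1,x_2][x_3,x_4]$ spans the sign representation of
  the symmetric group $S_5$ modulo \<^const>\<open>T4\<close>, so one wants a functional that transforms by the
  sign. Under all of $S_5$ this is impossible: such a functional is a multiple of the sign of the
  arrangement, and that one vanishes on $[x_0,x_1,x_2]$. But the group of affine maps
  $k \mapsto s + tk$ of $\mathbb{Z}/5$ has order 20, prime to 3, so a functional modulo 3 can be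
  averaged over it and may be taken to transform by the sign under this subgroup. The sign of
  $k \mapsto s + tk$ is the Legendre symbol of $t$: translations are 5-cycles, and multiplication
  by 2 is a 4-cycle. It remains to choose values on the six classes of arrangements. The value 1 on
  the class of $0,1,2,4,3$ (that is, 0 and then the powers of the primitive root 2), the value
  $-1$ on the reversed word $3,4,2,1,0$, and 0 on the other four classes solve the linear system
  that says that the brackets $u[a,b,c,d]v$ vanish modulo 3. By the symmetry this need only be
  checked for words that start with $0,1$ (\<open>brackets_vanish_234\<close>).
\<close>

section \<open>Products of a triple and a double commutator\<close>

text \<open>
  The computation holds in any ring, modulo any two-sided ideal that contains the commutators of
  length four.
\<close>

locale commutator4_ideal =
  fixes I :: "'a::ring set"
  assumes zero_mem: "0 \<in> I"
    and diff_mem: "x \<in> I \<Longrightarrow> y \<in> I \<Longrightarrow> x - y \<in> I"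
    and mult_left_mem: "x \<in> I \<Longrightarrow> r * x \<in> I"
    and mult_right_mem: "x \<in> I \<Longrightarrow> x * r \<in> I"
    and commutator4_mem: "commutator4 a b c d \<in> I"
begin

definition cong :: "'a \<Rightarrow> 'a \<Rightarrow> bool" (infix \<open>\<doteq>\<close> 50) where
  "x \<doteq> y \<longleftrightarrow> x - y \<in> I"

lemma uminus_mem: "x \<in> I \<Longrightarrow> - x \<in> I"
  using diff_mem[OF zero_mem] by simp

lemma add_mem: "x \<in> I \<Longrightarrow> y \<in> I \<Longrightarrow> x + y \<in> I"
  using diff_mem[OF _ uminus_mem] by simp

lemma cong_sym: "x \<doteq> y \<Longrightarrow> y \<doteq> x"
  unfolding cong_def using uminus_mem by fastforce

lemma cong_trans [trans]: "x \<doteq> y \<Longrightarrow> y \<doteq> z \<Longrightarrow> x \<doteq> z"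
  unfolding cong_def using add_mem by fastforce

lemma cong_minus: "x \<doteq> y \<Longrightarrow> - x \<doteq> - y"
  unfolding cong_def using uminus_mem by fastforce

lemma cong_add: "x \<doteq> y \<Longrightarrow> x' \<doteq> y' \<Longrightarrow> x + x' \<doteq> y + y'"
  unfolding cong_def by (drule (1) add_mem) (simp add: algebra_simps)

abbreviation comm32 :: "'a \<Rightarrow> 'a \<Rightarrow> 'a \<Rightarrow> 'a \<Rightarrow> 'a \<Rightarrow> 'a" where
  "comm32 a b c d e \<equiv> commutator3 a b c * commutator d e"

lemma swap_12: "comm32 a b c d e = - comm32 b a c d e"
  by (simp add: commutator_def algebra_simps)

lemma swap_45: "comm32 a b c d e = - comm32 a b c e d"
  by (simp add: commutator_def algebra_simps)

text \<open>
  Commuting $[[a,b],cd]$ with \<open>e\<close> gives $[a,b,c][d,e] + [c,e][a,b,d]$ up to commutators of length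
  four, and the last two factors commute modulo \<open>I\<close>.
\<close>

lemma swap_34: "comm32 a b c d e \<doteq> - comm32 a b d c e"
proof -
  have "comm32 a b c d e - (- comm32 a b d c e) = commutator4 a b (c * d) e
      + commutator4 a b d (commutator c e) - commutator4 a b c e * d - c * commutator4 a b d e"
    by (simp add: commutator_def algebra_simps)
  also have "\<dots> \<in> I"
    by (intro diff_mem add_mem mult_left_mem mult_right_mem commutator4_mem)
  finally show ?thesis unfolding cong_def .
qed

lemma swap_35: "comm32 a b c d e \<doteq> - comm32 a b e d c"
proof -
  have "comm32 a b c d e \<doteq> - comm32 a b d c e" by (rule swap_34)
  also have "- comm32 a b d c e = comm32 a b d e c" using swap_45[of a b d c e] by simp
  also have "comm32 a b d e c \<doteq> - comm32 a b e d c" by (rule swap_34)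
  finally show ?thesis .
qed

text \<open>
  The Leibniz expansion of $[ad,e,b,c]$ has six products of a double and a triple commutator. Four
  of them cancel in pairs by \<open>swap_35\<close>; the two that are left give the congruence.
\<close>

lemma swap_14: "comm32 a b c d e \<doteq> - comm32 d b c a e"
proof -
  have "comm32 a b c d e - (- comm32 d b c a e)
      = commutator4 (a * d) e b c - a * commutator4 d e b c - commutator4 a e b c * d
        + commutator4 d e b (commutator a c) + commutator4 d e c (commutator a b)
        + commutator4 d b c (commutator a e)
        - (comm32 d e b a c - (- comm32 d e c a b)) - (comm32 a e c d b - (- comm32 a e b d c))"
    by (simp add: commutator_def algebra_simps)
  also have "\<dots> \<in> I"
    \<comment> \<open>The congruences have to be tried first: the closure rules would split them.\<close>
    by (rule swap_35[unfolded cong_def] commutator4_mem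
        | rule diff_mem add_mem | rule mult_left_mem mult_right_mem)+
  finally show ?thesis unfolding cong_def .
qed

text \<open>
  The transposition of the first and the third argument is the conjugate of a transposition of
  the third and the fourth by one of the first and the fourth, hence also changes the sign.
\<close>

lemma rotate_123: "comm32 b c a d e \<doteq> comm32 a b c d e"
proof -
  have "comm32 b c a d e = - comm32 c b a d e" by (rule swap_12)
  also have "- comm32 c b a d e \<doteq> comm32 d b a c e" using cong_minus[OF swap_14[of c b a d e]] by simp
  also have "comm32 d b a c e \<doteq> - comm32 d b c a e" by (rule swap_34)
  also have "- comm32 d b c a e \<doteq> comm32 a b c d e" using cong_minus[OF swap_14[of d b c a e]] by simp
  finally show ?thesis .
qed

text \<open>
  By \<open>rotate_123\<close> the three terms of the Jacobi identity are congruent to each other.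
\<close>

theorem three_times_mem: "comm32 a b c d e + comm32 a b c d e + comm32 a b c d e \<in> I"
proof -
  have "comm32 c a b d e \<doteq> comm32 a b c d e"
    using cong_trans[OF rotate_123[of c a b d e] rotate_123[of b c a d e]] .
  then have "comm32 a b c d e + comm32 b c a d e + comm32 c a b d e
      \<doteq> comm32 a b c d e + comm32 a b c d e + comm32 a b c d e"
    by (intro cong_add rotate_123) (auto simp: cong_def zero_mem)
  then have "comm32 a b c d e + comm32 a b c d e + comm32 a b c d e
      \<doteq> comm32 a b c d e + comm32 b c a d e + comm32 c a b d e"
    by (rule cong_sym)
  also have "comm32 a b c d e + comm32 b c a d e + comm32 c a b d e = 0"
    by (simp add: commutator_def algebra_simps)
  finally show ?thesis
    unfolding cong_def by simp
qed

end

section \<open>Exponent 3\<close>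

lemma ZX_simps [simp]:
  "carrier ZX = UNIV" "monoid.mult ZX = (*)" "monoid.one ZX = 1" "ring.zero ZX = 0" "ring.add ZX = (+)"
  by (auto simp: ZX_def ring_of_type_algebra_def)

lemma ideal_ZX_iff:
  "ideal J ZX \<longleftrightarrow> 0 \<in> J \<and> (\<forall>x\<in>J. \<forall>y\<in>J. x - y \<in> J) \<and> (\<forall>x\<in>J. \<forall>r. r * x \<in> J \<and> x * r \<in> J)"
  (is "?L \<longleftrightarrow> ?R")
proof -
  interpret ring ZX by (rule ring_ZX)
  have minus: "\<ominus>\<^bsub>ZX\<^esub> x = - x" for x
    using minus_equality[of "- x" x] by simp
  show ?thesis
  proof
    assume ?L
    then interpret ideal J ZX .
    show ?R
      using a_closed a_inv_closed zero_closed I_l_closed I_r_closed minus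
      by (metis ZX_simps UNIV_I diff_conv_add_uminus)
  next
    assume R: ?R
    then have "- x \<in> J" if "x \<in> J" for x
      using that by (metis diff_0)
    moreover from this have "x + y \<in> J" if "x \<in> J" "y \<in> J" for x y
      using that R by (metis diff_minus_eq_add)
    ultimately show ?L
      using R minus by (intro idealI ring_ZX add.subgroupI) (auto simp flip: a_inv_def)
  qed
qed

lemma commutator4_ideal_T4: "commutator4_ideal T4"
proof -
  interpret ring ZX by (rule ring_ZX)
  have "ideal T4 ZX" unfolding T4_def by (rule genideal_ideal) simp
  moreover have "{commutator4 a b c d | a b c d. True} \<subseteq> T4"
    unfolding T4_def by (rule genideal_self) simp
  ultimately show ?thesis unfolding ideal_ZX_iff by unfold_locales blast+
qed

lemma T4_subset_T32: "T4 \<subseteq> T32"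
proof -
  interpret ring ZX by (rule ring_ZX)
  show ?thesis
    unfolding T4_def T32_def by (rule subset_Idl_subset) auto
qed

text \<open>
  The elements whose triple lies in \<^const>\<open>T4\<close> form an ideal, so it suffices to look at the
  generators of \<^const>\<open>T32\<close>.
\<close>

lemma three_times_T32:
  assumes "x \<in> T32"
  shows "x + x + x \<in> T4"
proof -
  interpret ring ZX by (rule ring_ZX)
  interpret T4: commutator4_ideal T4 by (rule commutator4_ideal_T4)
  let ?J = "{x. x + x + x \<in> T4}"
  have diff: "x - y + (x - y) + (x - y) = (x + x + x) - (y + y + y)" for x y :: free_ring
    by simp
  have "ideal ?J ZX"
    unfolding ideal_ZX_iff mem_Collect_eq
    using T4.zero_mem T4.diff_mem T4.mult_left_mem[of "_ + _ + _"] T4.mult_right_mem[of "_ + _ + _"]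
    by (auto simp: diff distrib_left distrib_right)
  moreover have "commutator4 a b c d \<in> ?J" for a b c d
    using T4.commutator4_mem T4.add_mem by simp
  ultimately have "T32 \<subseteq> ?J"
    unfolding T32_def using T4.three_times_mem by (intro genideal_minimal) auto
  with assms show ?thesis by blast
qed

section \<open>A weight on arrangements of five letters\<close>

definition affine :: "nat \<Rightarrow> nat \<Rightarrow> nat \<Rightarrow> nat" where
  "affine s t k = (s + t * k) mod 5"

lemma affine_mod: "affine (s mod 5) t = affine s t" "affine s (t mod 5) = affine s t"
  unfolding affine_def fun_eq_iff by (metis mod_add_left_eq mod_add_right_eq mod_mult_left_eq)+

lemma affine_affine: "affine s t (affine a d k) = affine (affine s t a) (t * d mod 5) k"
proof -
  have "affine s t (affine a d k) = affine (s + t * a) (t * d) k"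
    unfolding affine_def
    by (metis (no_types) mod_add_right_eq mod_mult_right_eq add.assoc distrib_left mult.assoc)
  also have "\<dots> = affine ((s + t * a) mod 5) (t * d mod 5) k"
    by (simp only: affine_mod)
  finally show ?thesis by (simp only: affine_def)
qed

text \<open>
  The letters 1, 2, 4, 3 are the successive powers of 2 modulo 5; so the differences of a geometric
  word to its first letter form a geometric progression with ratio 2.
\<close>

definition geometric_word :: "nat \<Rightarrow> nat \<Rightarrow> nat list" where
  "geometric_word s t = map (affine s t) [0, 1, 2, 4, 3]"

definition legendre5 :: "nat \<Rightarrow> int" where
  "legendre5 t = (if t \<in> {1, 4} then 1 else if t \<in> {2, 3} then - 1 else 0)"

text \<open>
  A geometric word determines its parameters modulo 5: \<open>s\<close> is the first letter and \<open>t\<close> is the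
  difference of the first two, where 4 stands for $-1$. If \<open>w\<close> has fewer than two letters, the parameters
  are unspecified, but the comparison with a word of five letters fails.
\<close>

definition geometric_sign :: "nat list \<Rightarrow> int" where
  "geometric_sign w = (let s = w ! 0; t = (w ! 1 + 4 * s) mod 5
     in if w = geometric_word s t then legendre5 t else 0)"

definition weight :: "nat list \<Rightarrow> int" where
  "weight w = geometric_sign w - geometric_sign (rev w)"

definition arrangement :: "nat list \<Rightarrow> bool" where
  "arrangement w \<longleftrightarrow> length w = 5 \<and> set w = {..<5}"

lemma less_5_cases: "(k::nat) < 5 \<longleftrightarrow> k \<in> {0, 1, 2, 3, 4}"
  by auto

lemma affine_bij:
  assumes "t \<in> {1, 2, 3, 4}"
  shows "bij_betw (affine s t) {..<5} {..<5}"
proof -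
  have "inj_on (affine s t) {..<5}"
  proof (rule inj_onI)
    fix k l assume "k \<in> {..<5}" "l \<in> {..<5}" "affine s t k = affine s t l"
    then have kl: "k < 5" "l < 5" and "(s + t * k) mod 5 = (s + t * l) mod 5"
      by (auto simp: affine_def)
    from this(3) have "t * k mod 5 = t * l mod 5"
      by (simp add: nat_mod_eq_iff)
    with assms kl show "k = l"
      unfolding less_5_cases by (elim insertE emptyE) simp_all
  qed
  moreover have "affine s t ` {..<5} \<subseteq> {..<5}"
    by (auto simp: affine_def)
  ultimately show ?thesis
    by (simp add: bij_betw_def endo_inj_surj)
qed

lemma arrangement_affine:
  assumes "t \<in> {1, 2, 3, 4}" "arrangement w"
  shows "arrangement (map (affine s t) w)"
  using affine_bij[OF assms(1)] assms(2) by (simp add: arrangement_def bij_betw_def)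

lemma arrangement_rev: "arrangement (rev w) \<longleftrightarrow> arrangement w"
  by (simp add: arrangement_def)

lemma geometric_sign_support:
  assumes "geometric_sign w \<noteq> 0"
  shows "arrangement w"
proof -
  have "arrangement [0, 1, 2, 4, 3]"
    by (auto simp: arrangement_def)
  moreover obtain s t where "w = geometric_word s t" "legendre5 t \<noteq> 0"
    using assms unfolding geometric_sign_def Let_def by metis
  moreover from this have "t \<in> {1, 2, 3, 4}"
    by (auto simp: legendre5_def split: if_splits)
  ultimately show ?thesis
    unfolding geometric_word_def using arrangement_affine by blast
qed

lemma weight_support: "weight w \<noteq> 0 \<Longrightarrow> arrangement w"
  using geometric_sign_support[of w] geometric_sign_support[of "rev w"]
  by (cases "geometric_sign w = 0") (auto simp: weight_def arrangement_rev)

lemma legendre5_mult: "a < 5 \<Longrightarrow> b < 5 \<Longrightarrow> legendre5 (a * b mod 5) = legendre5 a * legendre5 b"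
  unfolding less_5_cases by (elim insertE emptyE) (simp_all add: legendre5_def)

text \<open>
  Affine maps send geometric words to geometric words and multiply the parameter \<open>t\<close>, on which the
  Legendre symbol is multiplicative.
\<close>

lemma geometric_sign_affine:
  assumes t: "t \<in> {1, 2, 3, 4}" and w: "arrangement w"
  shows "geometric_sign (map (affine s t) w) = legendre5 t * geometric_sign w"
proof -
  define a d where "a = w ! 0" and "d = (w ! 1 + 4 * a) mod 5"
  let ?f = "affine s t"
  have len: "length w = 5" and letters: "set w \<subseteq> {..<5}"
    using w by (auto simp: arrangement_def)
  have diff: "(?f (w ! 1) + 4 * ?f a) mod 5 = t * d mod 5"
  proof -
    have "(x mod 5 + 4 * (y mod 5)) mod 5 = (x + 4 * y) mod 5" for x y :: nat
      by (metis mod_add_left_eq mod_add_right_eq mod_mult_right_eq)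
    then have "(?f (w ! 1) + 4 * ?f a) mod 5 = (t * (w ! 1 + 4 * a) + s * 5) mod 5"
      unfolding affine_def by (simp add: algebra_simps)
    then show ?thesis
      unfolding d_def mod_mult_self1 mod_mult_right_eq .
  qed
  have geometric: "geometric_word (?f a) (t * d mod 5) = map ?f (geometric_word a d)"
    by (simp add: geometric_word_def affine_affine)
  have "inj_on ?f {..<5}"
    using affine_bij[OF t] by (simp add: bij_betw_def)
  moreover have "set (geometric_word a d) \<subseteq> {..<5}"
    by (auto simp: geometric_word_def affine_def)
  ultimately have "map ?f w = map ?f (geometric_word a d) \<longleftrightarrow> w = geometric_word a d"
    using letters by (metis inj_on_map_eq_map inj_on_subset Un_least)
  moreover have "legendre5 (t * d mod 5) = legendre5 t * legendre5 d"
    using t by (intro legendre5_mult) (auto simp: d_def)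
  moreover have "map ?f w ! 0 = ?f a" "map ?f w ! 1 = ?f (w ! 1)"
    using len by (simp_all add: a_def)
  then have "geometric_sign (map ?f w) =
      (if map ?f w = map ?f (geometric_word a d) then legendre5 (t * d mod 5) else 0)"
    unfolding geometric_sign_def Let_def by (simp only: diff geometric)
  moreover have "geometric_sign w = (if w = geometric_word a d then legendre5 d else 0)"
    unfolding geometric_sign_def Let_def a_def d_def ..
  ultimately show ?thesis by simp
qed

lemma weight_affine:
  assumes "t \<in> {1, 2, 3, 4}" "arrangement w"
  shows "weight (map (affine s t) w) = legendre5 t * weight w"
  using geometric_sign_affine[OF assms(1)] assms(2)
  by (simp add: weight_def rev_map arrangement_rev algebra_simps)

text \<open>
  The signed sum of the weights of the eight words in the expansion of $u[a,b,c,d]v$.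
\<close>

definition bracket_weight ::
    "nat list \<Rightarrow> nat list \<Rightarrow> nat list \<Rightarrow> nat list \<Rightarrow> nat list \<Rightarrow> nat list \<Rightarrow> int" where
  "bracket_weight u a b c d v =
     weight (u @ a @ b @ c @ d @ v) - weight (u @ b @ a @ c @ d @ v)
   - weight (u @ c @ a @ b @ d @ v) + weight (u @ c @ b @ a @ d @ v)
   - weight (u @ d @ a @ b @ c @ v) + weight (u @ d @ b @ a @ c @ v)
   + weight (u @ d @ c @ a @ b @ v) - weight (u @ d @ c @ b @ a @ v)"

lemma bracket_weight_affine:
  assumes "t \<in> {1, 2, 3, 4}" "arrangement (u @ a @ b @ c @ d @ v)"
  shows "bracket_weight (map (affine s t) u) (map (affine s t) a) (map (affine s t) b)
      (map (affine s t) c) (map (affine s t) d) (map (affine s t) v)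
    = legendre5 t * bracket_weight u a b c d v"
proof -
  have "arrangement w \<Longrightarrow> weight (map (affine s t) w) = legendre5 t * weight w" for w
    by (rule weight_affine[OF assms(1)])
  note * = this[of "_ @ _ @ _ @ _ @ _ @ _", unfolded map_append]
  have "arrangement (u @ b @ a @ c @ d @ v)" "arrangement (u @ c @ a @ b @ d @ v)"
    "arrangement (u @ c @ b @ a @ d @ v)" "arrangement (u @ d @ a @ b @ c @ v)"
    "arrangement (u @ d @ b @ a @ c @ v)" "arrangement (u @ d @ c @ a @ b @ v)"
    "arrangement (u @ d @ c @ b @ a @ v)"
    using assms(2) unfolding arrangement_def by auto
  then show ?thesis
    using assms(2) unfolding bracket_weight_def by (simp add: * algebra_simps)
qed

text \<open>
  If \<open>a\<close>, \<open>b\<close>, \<open>c\<close>, \<open>d\<close> are nonempty and \<open>u @ a @ b @ c @ d @ v\<close> has five letters, exactly one letter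
  is left over after each of \<open>a\<close>, \<open>b\<close>, \<open>c\<close>, \<open>d\<close> has got one. It can go to any of the six places.
\<close>

definition brackets_vanish :: "nat \<Rightarrow> nat \<Rightarrow> nat \<Rightarrow> bool" where
  "brackets_vanish x y z \<longleftrightarrow>
     3 dvd bracket_weight [0] [1] [x] [y] [z] [] \<and>
     3 dvd bracket_weight [] [0, 1] [x] [y] [z] [] \<and>
     3 dvd bracket_weight [] [0] [1, x] [y] [z] [] \<and>
     3 dvd bracket_weight [] [0] [1] [x, y] [z] [] \<and>
     3 dvd bracket_weight [] [0] [1] [x] [y, z] [] \<and>
     3 dvd bracket_weight [] [0] [1] [x] [y] [z]"

lemma brackets_vanish_234:
  "brackets_vanish 2 3 4 \<and> brackets_vanish 2 4 3 \<and> brackets_vanish 3 2 4 \<and>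
   brackets_vanish 3 4 2 \<and> brackets_vanish 4 2 3 \<and> brackets_vanish 4 3 2"
  by code_simp

text \<open>
  The affine group is sharply 2-transitive on the five letters, so each of its classes of
  arrangements contains exactly one that starts with $0, 1$.
\<close>

lemma normalising_affine:
  assumes "p < 5" "q < 5" "p \<noteq> q"
  obtains s t where "t \<in> {1, 2, 3, 4}" "affine s t p = 0" "affine s t q = 1"
proof -
  have "\<exists>t\<in>{1, 2, 3, 4}. \<exists>s\<in>{0, 1, 2, 3, 4}. affine s t p = 0 \<and> affine s t q = 1"
    using assms unfolding less_5_cases
    by (elim insertE emptyE) (simp_all add: affine_def)
  with that show thesis by blast
qed

lemma bracket_weight_normalised:
  assumes arr: "arrangement (u @ a @ b @ c @ d @ v)" and ne: "a \<noteq> []" "b \<noteq> []" "c \<noteq> []" "d \<noteq> []"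
    and norm: "u @ a @ b @ c @ d @ v = [0, 1, x, y, z]"
  shows "3 dvd bracket_weight u a b c d v"
proof -
  have "set [0, 1, x, y, z] = {..<5}"
    using arr norm by (simp add: arrangement_def)
  then have "k \<in> set [0, 1, x, y, z]" if "k < 5" for k
    using that by blast
  from this[of 2] this[of 3] this[of 4] have "2 \<in> {x, y, z}" "3 \<in> {x, y, z}" "4 \<in> {x, y, z}"
    by simp_all
  then have "(x, y, z) \<in> {(2,3,4), (2,4,3), (3,2,4), (3,4,2), (4,2,3), (4,3,2)}"
    by (elim insertE emptyE) simp_all
  then have vanish: "brackets_vanish x y z"
    using brackets_vanish_234 by auto
  obtain a0 a' b0 b' c0 c' d0 d' where split: "a = a0 # a'" "b = b0 # b'" "c = c0 # c'" "d = d0 # d'"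
    using ne by (metis neq_Nil_conv)
  have "length u + length a' + length b' + length c' + length d' + length v = Suc 0"
    using arg_cong[OF norm, of length] unfolding split by simp
  then show ?thesis
    using norm vanish unfolding brackets_vanish_def split add_is_1 add_is_0
    by (elim disjE conjE) (auto simp: length_Suc_conv)
qed

text \<open>
  If one of the four entries is the empty word, it represents the unit of the ring and the terms
  cancel; if the letters do not form an arrangement, all eight weights are 0. In the remaining case
  an affine map changes the bracket weight by a sign at most and moves the first two letters to
  $0, 1$.
\<close>

lemma bracket_weight_vanishes: "3 dvd bracket_weight u a b c d v"
proof (cases "arrangement (u @ a @ b @ c @ d @ v) \<and> a \<noteq> [] \<and> b \<noteq> [] \<and> c \<noteq> [] \<and> d \<noteq> []")
  case True
  then have arr: "arrangement (u @ a @ b @ c @ d @ v)" and ne: "a \<noteq> []" "b \<noteq> []" "c \<noteq> []" "d \<noteq> []"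
    by auto
  have "\<exists>p q x y z. w = [p, q, x, y, z]" if "length w = 5" for w :: "nat list"
    using that by (auto simp: eval_nat_numeral length_Suc_conv)
  then obtain p q x y z where pq: "u @ a @ b @ c @ d @ v = [p, q, x, y, z]"
    using arr unfolding arrangement_def by meson
  have "set [p, q, x, y, z] = {..<5}"
    using arr unfolding pq arrangement_def by blast
  then have "card (set [p, q, x, y, z]) = length [p, q, x, y, z]" "set [p, q, x, y, z] \<subseteq> {..<5}"
    by (simp_all only: card_lessThan) simp_all
  from card_distinct[OF this(1)] this(2) have "p < 5" "q < 5" "p \<noteq> q"
    by simp_all
  then obtain s t where t: "t \<in> {1, 2, 3, 4}" and 01: "affine s t p = 0" "affine s t q = 1"
    by (rule normalising_affine)
  let ?f = "map (affine s t)"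
  have "?f u @ ?f a @ ?f b @ ?f c @ ?f d @ ?f v = ?f (u @ a @ b @ c @ d @ v)"
    by simp
  also have "\<dots> = [0, 1, affine s t x, affine s t y, affine s t z]"
    unfolding pq using 01 by simp
  finally have norm: "?f u @ ?f a @ ?f b @ ?f c @ ?f d @ ?f v = \<dots>" .
  have "arrangement (?f u @ ?f a @ ?f b @ ?f c @ ?f d @ ?f v)"
    using arrangement_affine[OF t arr] by simp
  from bracket_weight_normalised[OF this _ _ _ _ norm]
  have "3 dvd legendre5 t * bracket_weight u a b c d v"
    using ne bracket_weight_affine[OF t arr] by simp
  moreover have "legendre5 t = 1 \<or> legendre5 t = - 1"
    using t by (auto simp: legendre5_def)
  ultimately show ?thesis by auto
next
  case False
  then consider "a = [] \<or> b = [] \<or> c = [] \<or> d = []" | "\<not> arrangement (u @ a @ b @ c @ d @ v)"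
    by blast
  then show ?thesis
  proof cases
    case 1
    then show ?thesis unfolding bracket_weight_def by auto
  next
    case 2
    then have "weight w = 0" if "length w = length (u @ a @ b @ c @ d @ v)"
      "set w = set (u @ a @ b @ c @ d @ v)" for w
      using that weight_support[of w] unfolding arrangement_def by metis
    then have "bracket_weight u a b c d v = 0"
      unfolding bracket_weight_def by (simp add: Un_ac)
    then show ?thesis by simp
  qed
qed

section \<open>A functional modulo 3 on the free ring\<close>

definition functional :: "free_ring \<Rightarrow> int" where
  "functional p = (\<Sum>w | arrangement w. weight w * Poly_Mapping.lookup p (Word w))"

lemma functional_add: "functional (p + q) = functional p + functional q"
  unfolding functional_def sum.distrib [symmetric]
  by (intro sum.cong refl) (simp add: lookup_add algebra_simps)

lemma functional_diff: "functional (p - q) = functional p - functional q"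
  unfolding functional_def sum_subtractf [symmetric]
  by (intro sum.cong refl) (simp add: lookup_minus algebra_simps)

lemma functional_word: "functional (Poly_Mapping.single (Word w) 1) = weight w"
proof -
  have "finite {w. arrangement w}"
    by (rule finite_subset[OF _ finite_lists_length_eq[of "{..<5}" 5]]) (auto simp: arrangement_def)
  then have "functional (Poly_Mapping.single (Word w) 1) = (if arrangement w then weight w else 0)"
    unfolding functional_def
    by (simp add: lookup_single when_def if_distrib sum.delta' cong: if_cong)
  then show ?thesis using weight_support by auto
qed

lemma commutator4_expand:
  fixes u a b c d v :: "'a::ring"
  shows "u * commutator4 a b c d * v =
     u * a * b * c * d * v - u * b * a * c * d * v - u * c * a * b * d * v + u * c * b * a * d * v
   - u * d * a * b * c * v + u * d * b * a * c * v + u * d * c * a * b * v - u * d * c * b * a * v"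
  by (simp add: commutator_def algebra_simps)

lemma functional_words:
  "functional (Poly_Mapping.single (Word u) 1
     * commutator4 (Poly_Mapping.single (Word a) 1) (Poly_Mapping.single (Word b) 1)
         (Poly_Mapping.single (Word c) 1) (Poly_Mapping.single (Word d) 1)
     * Poly_Mapping.single (Word v) 1) = bracket_weight u a b c d v"
  by (simp add: commutator4_expand bracket_weight_def mult_single
      plus_word_def functional_add functional_diff functional_word)

text \<open>
  The free ring is the free abelian group on the words, so the divisibility of a multiadditive
  expression can be checked on words, one argument at a time.
\<close>

lemma additive_dvd:
  fixes f :: "('a \<Rightarrow>\<^sub>0 int) \<Rightarrow> int"
  assumes "\<And>p q. f (p - q) = f p - f q" "\<And>w. n dvd f (Poly_Mapping.single w 1)"
  shows "n dvd f p"
proof (rule frag_induction[of p UNIV])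
  show "n dvd f 0" using assms(1)[of 0 0] by simp
qed (use assms in auto)

lemma functional_T4_generators: "3 dvd functional (u * commutator4 a b c d * v)"
proof -
  have minus: "commutator (p - q) r = commutator p r - commutator q r"
    "commutator r (p - q) = commutator r p - commutator r q" for p q r :: free_ring
    by (simp_all add: commutator_def algebra_simps)
  note simps = functional_diff minus left_diff_distrib right_diff_distrib
  note additive = additive_dvd[where n = 3]
  let ?W = "\<lambda>w. Poly_Mapping.single w 1 :: free_ring"
  have "3 dvd functional (?W u * commutator4 (?W a) (?W b) (?W c) (?W d) * ?W v)" for u a b c d v
    using functional_words bracket_weight_vanishes by (metis word.exhaust)
  then have "3 dvd functional (?W u * commutator4 (?W a) (?W b) (?W c) (?W d) * v)" for u a b c d v
    by (rule additive[rotated]) (simp only: simps)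
  then have "3 dvd functional (?W u * commutator4 (?W a) (?W b) (?W c) d * v)" for u a b c d v
    by (rule additive[rotated]) (simp only: simps)
  then have "3 dvd functional (?W u * commutator4 (?W a) (?W b) c d * v)" for u a b c d v
    by (rule additive[rotated]) (simp only: simps)
  then have "3 dvd functional (?W u * commutator4 (?W a) b c d * v)" for u a b c d v
    by (rule additive[rotated]) (simp only: simps)
  then have "3 dvd functional (?W u * commutator4 a b c d * v)" for u a b c d v
    by (rule additive[rotated]) (simp only: simps)
  then show ?thesis
    by (rule additive[rotated]) (simp only: simps)
qed

text \<open>
  Divisibility of the functional has to hold after multiplication with arbitrary elements from both
  sides: in this form it defines an ideal, and the minimality of the generated ideal applies.
\<close>

lemma functional_T4:
  assumes "x \<in> T4"
  shows "3 dvd functional x"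
proof -
  interpret ring ZX by (rule ring_ZX)
  let ?J = "{x. \<forall>u v. 3 dvd functional (u * x * v)}"
  have zero: "functional 0 = 0"
    using functional_diff[of 0 0] by simp
  have "ideal ?J ZX"
    unfolding ideal_ZX_iff mem_Collect_eq
  proof (intro conjI ballI allI)
    show "3 dvd functional (u * 0 * v)" for u v
      by (simp add: zero)
    fix x assume x: "x \<in> ?J"
    show "3 dvd functional (u * (x - y) * v)" if "y \<in> ?J" for y u v
      using x that by (simp add: left_diff_distrib right_diff_distrib functional_diff)
    show "3 dvd functional (u * (r * x) * v)" "3 dvd functional (u * (x * r) * v)" for r u v
      using x by (simp_all flip: mult.assoc) (simp add: mult.assoc[of "u * x"])
  qed
  then have "T4 \<subseteq> ?J"
    unfolding T4_def using functional_T4_generators by (intro genideal_minimal) auto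
  with assms have "3 dvd functional (1 * x * 1)" by blast
  then show ?thesis by simp
qed

lemma T32_neq_T4: "\<exists>x\<in>T32. x \<notin> T4"
proof -
  interpret ring ZX by (rule ring_ZX)
  let ?x = "\<lambda>i. Poly_Mapping.single (Word [i]) 1 :: free_ring"
  let ?p = "commutator3 (?x 0) (?x 1) (?x 2) * commutator (?x 3) (?x 4)"
  have "?p \<in> T32"
    unfolding T32_def by (rule subsetD[OF genideal_self]) (simp, blast)
  moreover have "functional ?p =
      weight [0,1,2,3,4] - weight [0,1,2,4,3] - weight [1,0,2,3,4] + weight [1,0,2,4,3]
    - weight [2,0,1,3,4] + weight [2,0,1,4,3] + weight [2,1,0,3,4] - weight [2,1,0,4,3]"
    by (simp add: commutator_def algebra_simps mult_single plus_word_def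
        functional_add functional_diff flip: functional_word)
  moreover have "\<dots> mod 3 \<noteq> 0"
    by code_simp
  ultimately show ?thesis
    using functional_T4 by (metis dvd_eq_mod_eq_0)
qed

section \<open>The quotient group\<close>

text \<open>
  The order of every coset divides 3 by \<open>three_times_T32\<close>, and the coset of an element of \<^const>\<open>T32\<close>
  outside \<^const>\<open>T4\<close>, which exists by \<open>T32_neq_T4\<close>, is not the identity.
\<close>

theorem corollary1p2:
  shows "elementary_abelian_group 3 T32_mod_T4 \<and> carrier T32_mod_T4 \<noteq> {\<one>\<^bsub>T32_mod_T4\<^esub>}"
proof -
  let ?R = "ZX\<lparr>carrier := T32\<rparr>"
  interpret ZX: ring ZX by (rule ring_ZX)
  interpret T4: commutator4_ideal T4 by (rule commutator4_ideal_T4)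
  have "ideal T32 ZX"
    unfolding T32_def by (rule ZX.genideal_ideal) simp
  then have T32: "0 \<in> T32" "\<And>x y. x \<in> T32 \<Longrightarrow> y \<in> T32 \<Longrightarrow> x - y \<in> T32"
    unfolding ideal_ZX_iff by auto
  then have T32_uminus: "- x \<in> T32" if "x \<in> T32" for x
    using that by (metis diff_0)
  then have T32_add: "x + y \<in> T32" if "x \<in> T32" "y \<in> T32" for x y
    using that T32(2) by (metis diff_minus_eq_add)
  have group: "abelian_group ?R"
    using T32 T32_add T32_uminus
    by (intro abelian_groupI) (auto simp: add.assoc add.commute intro!: bexI[of _ "- _"])
  have "subgroup T4 (add_monoid ?R)"
  proof (rule group.subgroupI)
    show "group (add_monoid ?R)"
      using group by (rule abelian_group.a_group)
    then show "inv\<^bsub>add_monoid ?R\<^esub> x \<in> T4" if "x \<in> T4" for x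
      using that group.inv_equality[of "add_monoid ?R" "- x" x] T4_subset_T32 T32_uminus
        T4.uminus_mem by auto
  qed (use T4.zero_mem T4.add_mem T4_subset_T32 in auto)
  then interpret Q: abelian_subgroup T4 ?R
    using group by (intro abelian_subgroupI3 additive_subgroup.intro)
  have one: "\<one>\<^bsub>T32_mod_T4\<^esub> = T4"
    by (simp add: T32_mod_T4_def A_FactGroup_def)
  have carrier: "carrier T32_mod_T4 = (\<lambda>x. T4 #>\<^bsub>add_monoid ?R\<^esub> x) ` T32"
    by (simp add: T32_mod_T4_def A_FactGroup_def carrier_FactGroup)
  have "C [^]\<^bsub>T32_mod_T4\<^esub> (3::nat) = \<one>\<^bsub>T32_mod_T4\<^esub>" if C: "C \<in> carrier T32_mod_T4" for C
  proof -
    from C obtain x where x: "x \<in> T32" "C = T4 #>\<^bsub>add_monoid ?R\<^esub> x"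
      unfolding carrier by blast
    have "C [^]\<^bsub>T32_mod_T4\<^esub> (3::nat) = T4 #>\<^bsub>add_monoid ?R\<^esub> (x [^]\<^bsub>add_monoid ?R\<^esub> (3::nat))"
      unfolding T32_mod_T4_def A_FactGroup_def x(2)
      using x(1) by (intro normal.FactGroup_pow[OF Q.a_normal]) simp
    also have "x [^]\<^bsub>add_monoid ?R\<^esub> (3::nat) = x + x + x"
      by (simp add: numeral_3_eq_3 nat_pow_def)
    also have "T4 #>\<^bsub>add_monoid ?R\<^esub> (x + x + x) = T4"
      using three_times_T32[OF x(1)] Q.a_rcos_const by (simp add: a_r_coset_def)
    finally show ?thesis unfolding one .
  qed
  moreover have "comm_group T32_mod_T4"
    unfolding T32_mod_T4_def by (rule Q.a_factorgroup_is_comm_group)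
  moreover have "Factorial_Ring.prime (3::nat)"
    by simp
  moreover have "carrier T32_mod_T4 \<noteq> {T4}"
  proof
    assume trivial: "carrier T32_mod_T4 = {T4}"
    obtain x where x: "x \<in> T32" "x \<notin> T4"
      using T32_neq_T4 by blast
    then have "T4 #>\<^bsub>add_monoid ?R\<^esub> x = T4"
      using trivial unfolding carrier by blast
    moreover have "x \<in> T4 #>\<^bsub>add_monoid ?R\<^esub> x"
      using T4.zero_mem by (force simp: r_coset_def)
    ultimately show False using x(2) by blast
  qed
  ultimately show ?thesis
    unfolding elementary_abelian_group_def one by blast
qed

end
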